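(* Let $\alpha>0$ be a real number and $q=\exp(-2\alpha^2)$. Let $0<a<x<1$ and let $b,c,d$ be parameters (complex numbers) with $|abcd/q^3|<1$. Then $$ \int_{-\infty}^{\infty}h(i\sinh\alpha t;a,b,c,d)\,e^{-t^2}\cosh(\alpha t)\sum_{k=0}^{\infty}\frac{x^{\alpha+k}(a/x;q)_{\alpha+k}}{a^{k}(q;q)_{\alpha+k}}\;{}_4\phi_3\left[\begin{matrix}q^{-k},\,ab/q,\,ac/q,\,ad/q\\ iae^{\alpha t},\,-iae^{-\alpha t},\,abcd/q^3\end{matrix};q,q\right]dt $$ $$ =\sqrt{\pi}\,q^{-1/8}\,\frac{(ab/q,ac/q,ad/q,bc/q,bd/q,cd/q;q)_\infty}{(abcd/q^3;q)_\infty}\cdot\frac{x^{\alpha}(a/x;q)_\alpha}{(q;q)_\alpha}. $$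
   Context: Notation ($0<q<1$). $(c;q)_0=1$, $(c;q)_n=\prod_{k=0}^{n-1}(1-cq^k)$, $(c;q)_\infty=\prod_{k=0}^{\infty}(1-cq^k)$; for real $\nu$, $(c;q)_\nu=(c;q)_\infty/(cq^{\nu};q)_\infty$ (the standard extension). For $n$ a nonnegative integer or $\infty$, $(c_1,\dots,c_m;q)_n=(c_1;q)_n\cdots(c_m;q)_n$. Basic hypergeometric series: $${}_r\phi_s\left[\begin{matrix}a_1,\dots,a_r\\ b_1,\dots,b_s\end{matrix};q,w\right]=\sum_{n=0}^\infty\frac{(a_1,\dots,a_r;q)_n}{(q,b_1,\dots,b_s;q)_n}\left[(-1)^nq^{n(n-1)/2}\right]^{1+s-r}w^n ;$$ in particular, with $q^{-k}$ as an upper parameter ($k$ a nonnegative integer) the series terminates at $n=k$. $h(i\sinh\alpha t;p)=\prod_{k=0}^\infty(1-2iq^kp\sinh\alpha t+q^{2k}p^2)=(ipe^{\alpha t},-ipe^{-\alpha t};q)_\infty$, and $h(i\sinh\alpha t;p_1,\dots,p_m)=h(i\sinh\alpha t;p_1)\cdots h(i\sinh\alpha t;p_m)$.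
   Formalization: The left-hand side is additionally assumed to converge absolutely (the series for every t, and the integral of the weight times the sum of absolute values); without this the series can diverge, e.g. for c=d=0 and q/x<b<q/a. *)

theory Defs
  imports "HOL-Analysis.Analysis"
begin

definition qpoch :: "complex \<Rightarrow> real \<Rightarrow> nat \<Rightarrow> complex" where
  "qpoch c q n = (\<Prod>k<n. 1 - c * of_real (q ^ k))"

definition qpoch_inf :: "complex \<Rightarrow> real \<Rightarrow> complex" where
  "qpoch_inf c q = (\<Prod>k. 1 - c * of_real (q ^ k))"

definition qpoch_real :: "complex \<Rightarrow> real \<Rightarrow> real \<Rightarrow> complex" where
  "qpoch_real c q \<nu> = qpoch_inf c q / qpoch_inf (c * of_real (q powr \<nu>)) q"

definition qpochs :: "complex list \<Rightarrow> real \<Rightarrow> nat \<Rightarrow> complex" where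
  "qpochs cs q n = (\<Prod>c\<leftarrow>cs. qpoch c q n)"

definition qpochs_inf :: "complex list \<Rightarrow> real \<Rightarrow> complex" where
  "qpochs_inf cs q = (\<Prod>c\<leftarrow>cs. qpoch_inf c q)"

text \<open>The basic hypergeometric series with upper parameters \<open>as\<close> and lower parameters
  \<open>bs\<close>. The exponent \<open>1 + s - r\<close> may be negative, hence the integer power.\<close>

definition qhyp :: "complex list \<Rightarrow> complex list \<Rightarrow> real \<Rightarrow> complex \<Rightarrow> complex" where
  "qhyp as bs q w =
     (\<Sum>n. qpochs as q n / qpochs (of_real q # bs) q n
          * ((- 1) ^ n * of_real (q ^ (n * (n - 1) div 2)))
              powi (1 + int (length bs) - int (length as))
          * w ^ n)"

text \<open>The first argument is the point at which \<open>h\<close> is evaluated; below it is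
  \<open>\<i> * sinh (\<alpha> * t)\<close>.\<close>

definition h_prod :: "complex \<Rightarrow> real \<Rightarrow> complex \<Rightarrow> complex" where
  "h_prod z q p = (\<Prod>k. 1 - 2 * of_real (q ^ k) * p * z + of_real (q ^ (2 * k)) * p ^ 2)"

definition h_prods :: "complex \<Rightarrow> real \<Rightarrow> complex list \<Rightarrow> complex" where
  "h_prods z q ps = (\<Prod>p\<leftarrow>ps. h_prod z q p)"

definition h_weight :: "real \<Rightarrow> real \<Rightarrow> complex list \<Rightarrow> real \<Rightarrow> complex" where
  "h_weight \<alpha> q ps t =
     h_prods (\<i> * of_real (sinh (\<alpha> * t))) q ps * of_real (exp (- (t ^ 2)) * cosh (\<alpha> * t))"

definition series_term ::
  "real \<Rightarrow> real \<Rightarrow> real \<Rightarrow> complex \<Rightarrow> complex \<Rightarrow> complex \<Rightarrow> real \<Rightarrow> real \<Rightarrow> nat \<Rightarrow> complex" where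
  "series_term \<alpha> q a b c d x t k =
     of_real (x powr (\<alpha> + real k)) * qpoch_real (of_real (a / x)) q (\<alpha> + real k)
       / (of_real (a ^ k) * qpoch_real (of_real q) q (\<alpha> + real k))
     * qhyp
         [of_real (q powi (- int k)), of_real a * b / of_real q,
          of_real a * c / of_real q, of_real a * d / of_real q]
         [\<i> * of_real (a * exp (\<alpha> * t)), - \<i> * of_real (a * exp (- \<alpha> * t)),
          of_real a * b * c * d / of_real (q ^ 3)]
         q (of_real q)"

end

theory Submission
  imports Defs "HOL-Probability.Sinc_Integral" "HOL-Probability.Distributions"
    "HOL-Real_Asymp.Real_Asymp"
begin

text \<open>Let \<open>J a b c d\<close> be the integral of \<open>h(i sinh \<alpha>t; a, b, c, d) exp(-t\<^sup>2) cosh \<alpha>t\<close>. Since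
  \<open>exp(\<alpha>(t + \<alpha>)) = q powr (-1/2) exp(\<alpha>t)\<close>, the infinite products transform by elementary factors under
  real translations, and \<open>(1 - abcd/q\<^sup>3) h(a,b,c,d) - (1 - ab/q) (1 - ac/q) (1 - ad/q) h(aq,b,c,d)\<close>,
  times the weight, is a difference \<open>f(t + \<alpha>) - f(t - \<alpha>)\<close> up to a constant. Its integral vanishes,
  which relates \<open>J a b c d\<close> to \<open>J (aq) b c d\<close>. Iterating sends \<open>a\<close> to \<open>0\<close>; doing the same for the
  other parameters reduces \<open>J\<close> to a Gaussian integral. In the theorem, the factor \<open>h(\<dots>; a)\<close> absorbs
  the lower parameters of the \<open>4\<phi>3\<close> by shifting \<open>a\<close> to \<open>a q ^ n\<close>, so integrating termwise leaves a
  terminating sum that vanishes for all \<open>k > 0\<close>.\<close>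

section \<open>Infinite q-shifted factorials\<close>

lemma convergent_prod_qpoch:
  fixes c :: complex
  assumes "0 < q" "q < 1"
  shows "convergent_prod (\<lambda>k. 1 - c * of_real (q ^ k))"
proof -
  have "summable (\<lambda>k. norm (c * of_real (q ^ k)))"
    using assms by (simp add: norm_mult norm_power)
  then show ?thesis
    by (intro abs_convergent_prod_imp_convergent_prod summable_imp_abs_convergent_prod) simp
qed

lemma qpoch_LIMSEQ:
  assumes "0 < q" "q < 1"
  shows "(\<lambda>n. qpoch c q n) \<longlonglongrightarrow> qpoch_inf c q"
  using convergent_prod_LIMSEQ[OF convergent_prod_qpoch[OF assms]]
  unfolding qpoch_def qpoch_inf_def by (simp add: LIMSEQ_lessThan_iff_atMost)

lemma qpoch_0 [simp]: "qpoch c q 0 = 1"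
  by (simp add: qpoch_def)

lemma qpoch_Suc: "qpoch c q (Suc n) = qpoch c q n * (1 - c * of_real (q ^ n))"
  by (simp add: qpoch_def)

lemma qpoch_Suc_shift: "qpoch c q (Suc n) = (1 - c) * qpoch (c * of_real q) q n"
  unfolding qpoch_def prod.lessThan_Suc_shift by (simp add: mult.assoc)

lemma qpoch_inf_zero [simp]: "qpoch_inf 0 q = 1"
  by (simp add: qpoch_inf_def)

lemma qpoch_inf_rec:
  assumes "0 < q" "q < 1"
  shows "qpoch_inf c q = (1 - c) * qpoch_inf (c * of_real q) q"
proof (rule LIMSEQ_unique)
  show "(\<lambda>n. qpoch c q (Suc n)) \<longlonglongrightarrow> qpoch_inf c q"
    using qpoch_LIMSEQ[OF assms] by (rule LIMSEQ_Suc)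
  show "(\<lambda>n. qpoch c q (Suc n)) \<longlonglongrightarrow> (1 - c) * qpoch_inf (c * of_real q) q"
    unfolding qpoch_Suc_shift by (intro tendsto_intros qpoch_LIMSEQ assms)
qed

lemma qpoch_inf_split:
  assumes "0 < q" "q < 1"
  shows "qpoch_inf c q = qpoch c q n * qpoch_inf (c * of_real (q ^ n)) q"
proof (induction n)
  case (Suc n)
  then show ?case
    using qpoch_inf_rec[OF assms, of "c * of_real (q ^ n)"]
    by (simp add: qpoch_Suc mult_ac)
qed simp

text \<open>Each factor satisfies |1 - c q^k| \<le> 1 + r q^k, so the value at the negative real
  point \<open>-r\<close> dominates all \<open>c\<close> with |c| \<le> r. Later bounds therefore
  depend on a parameter only through its modulus.\<close>

lemma norm_qpoch_le:
  assumes "0 < q" "norm c \<le> r"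
  shows "norm (qpoch c q n) \<le> norm (qpoch (- of_real r) q n)"
proof -
  have r: "0 \<le> r" using assms(2) norm_ge_zero order_trans by blast
  have "norm (1 - c * of_real (q ^ k)) \<le> norm (1 + of_real r * of_real (q ^ k) :: complex)" for k
  proof -
    have "norm (1 - c * of_real (q ^ k)) \<le> 1 + norm c * q ^ k"
      using norm_triangle_ineq4[of 1 "c * of_real (q ^ k)"] assms(1)
      by (simp add: norm_mult norm_power)
    also have "\<dots> \<le> 1 + r * q ^ k"
      using assms by (intro add_left_mono mult_right_mono) auto
    also have "\<dots> = norm (of_real (1 + r * q ^ k) :: complex)"
      using r assms(1) by (simp only: norm_of_real) simp
    finally show ?thesis by simp
  qed
  then show ?thesis
    unfolding qpoch_def prod_norm[symmetric] by (intro prod_mono) auto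
qed

lemma norm_qpoch_inf_le:
  assumes "0 < q" "q < 1" "norm c \<le> r"
  shows "norm (qpoch_inf c q) \<le> norm (qpoch_inf (- of_real r) q)"
  by (rule LIMSEQ_le[OF tendsto_norm[OF qpoch_LIMSEQ[OF assms(1,2)]]
        tendsto_norm[OF qpoch_LIMSEQ[OF assms(1,2)]]])
    (use norm_qpoch_le[OF assms(1,3)] in auto)

text \<open>For u_k = -c q^k, the distance of prod (1 + u_k) from 1 is at most prod (1 + |u_k|) - 1,
  hence at most exp (sum |u_k|) - 1, and the sum is bounded by a geometric series. The bound is
  uniform in the number of factors and yields continuity at c = 0.\<close>

lemma norm_qpoch_inf_minus_1_le:
  assumes "0 < q" "q < 1"
  shows "norm (qpoch_inf c q - 1) \<le> exp (norm c / (1 - q)) - 1"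
proof (rule LIMSEQ_le_const2)
  show "(\<lambda>n. norm (qpoch c q n - 1)) \<longlonglongrightarrow> norm (qpoch_inf c q - 1)"
    by (intro tendsto_intros qpoch_LIMSEQ assms)
  have "norm (qpoch c q n - 1) \<le> exp (norm c / (1 - q)) - 1" for n
  proof -
    have "norm (qpoch c q n - 1) \<le> (\<Prod>k<n. 1 + norm (- c * of_real (q ^ k))) - 1"
      unfolding qpoch_def
      using norm_prod_minus1_le_prod_minus1[of "\<lambda>k. - c * of_real (q ^ k)" "{..<n}"] by simp
    also have "(\<Prod>k<n. 1 + norm (- c * of_real (q ^ k))) \<le> exp (\<Sum>k<n. norm (- c * of_real (q ^ k)))"
      by (rule prod_le_exp_sum) auto
    also have "(\<Sum>k<n. norm (- c * of_real (q ^ k))) = norm c * (\<Sum>k<n. q ^ k)"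
      using assms by (simp add: norm_mult norm_power sum_distrib_left)
    also have "exp \<dots> \<le> exp (norm c * (\<Sum>k. q ^ k))"
      using assms by (simp add: mult_left_mono sum_le_suminf)
    also have "(\<Sum>k. q ^ k) = 1 / (1 - q)"
      using assms by (simp add: suminf_geometric)
    finally show ?thesis by simp
  qed
  then show "\<exists>N. \<forall>n\<ge>N. norm (qpoch c q n - 1) \<le> exp (norm c / (1 - q)) - 1"
    by blast
qed

lemma qpoch_inf_tendsto_1:
  assumes "0 < q" "q < 1" and "f \<longlonglongrightarrow> 0"
  shows "(\<lambda>n. qpoch_inf (f n) q) \<longlonglongrightarrow> 1"
proof (rule Lim_null_comparison[where f = "\<lambda>n. qpoch_inf (f n) q - 1", THEN LIM_zero_cancel])
  show "\<forall>\<^sub>F n in sequentially. norm (qpoch_inf (f n) q - 1) \<le> exp (norm (f n) / (1 - q)) - 1"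
    using norm_qpoch_inf_minus_1_le[OF assms(1,2)] by simp
  have "(\<lambda>n. exp (norm (f n) / (1 - q)) - 1) \<longlonglongrightarrow> exp (norm (0::complex) / (1 - q)) - 1"
    using assms by (intro tendsto_intros) auto
  then show "(\<lambda>n. exp (norm (f n) / (1 - q)) - 1) \<longlonglongrightarrow> 0"
    by simp
qed

lemma qpoch_nonzero:
  assumes "0 < q" "q < 1" "norm c < 1"
  shows "qpoch c q n \<noteq> 0"
proof -
  have "1 - c * of_real (q ^ k) \<noteq> 0" for k
  proof
    assume "1 - c * of_real (q ^ k) = 0"
    then have "norm (c * of_real (q ^ k)) = 1" by simp
    moreover have "norm (c * of_real (q ^ k)) = norm c * q ^ k"
      using assms by (simp add: norm_mult norm_power)
    moreover have "norm c * q ^ k \<le> norm c * 1"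
      using assms by (intro mult_left_mono power_le_one) auto
    ultimately show False using assms(3) by linarith
  qed
  then show ?thesis by (simp add: qpoch_def)
qed

text \<open>The tail \<open>qpoch_inf (c * of_real (q ^ n)) q\<close> tends to 1, so it is nonzero
  for some \<open>n\<close>; the finitely many factors before it are nonzero because |c q^k| <
  1.\<close>

lemma qpoch_inf_nonzero:
  assumes "0 < q" "q < 1" "norm c < 1"
  shows "qpoch_inf c q \<noteq> 0"
proof -
  have "(\<lambda>n. c * of_real (q ^ n)) \<longlonglongrightarrow> c * of_real 0"
    using assms by (intro tendsto_intros LIMSEQ_realpow_zero) auto
  then have "(\<lambda>n. qpoch_inf (c * of_real (q ^ n)) q) \<longlonglongrightarrow> 1"
    by (intro qpoch_inf_tendsto_1 assms) simp
  then have "\<forall>\<^sub>F n in sequentially. qpoch_inf (c * of_real (q ^ n)) q \<noteq> 0"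
    by (rule tendsto_imp_eventually_ne) simp
  then obtain n where n: "qpoch_inf (c * of_real (q ^ n)) q \<noteq> 0"
    by (auto simp: eventually_sequentially)
  with qpoch_nonzero[OF assms] show ?thesis by (subst qpoch_inf_split[OF assms(1,2), of _ n]) simp
qed

lemma borel_measurable_qpoch_inf [measurable]:
  assumes "0 < q" "q < 1" and [measurable]: "f \<in> borel_measurable M"
  shows "(\<lambda>x. qpoch_inf (f x) q) \<in> borel_measurable M"
proof (rule borel_measurable_LIMSEQ_metric)
  show "(\<lambda>x. qpoch (f x) q n) \<in> borel_measurable M" for n
    unfolding qpoch_def by measurable
  show "(\<lambda>n. qpoch (f x) q n) \<longlonglongrightarrow> qpoch_inf (f x) q" for x
    by (rule qpoch_LIMSEQ[OF assms(1,2)])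
qed

section \<open>Factorisation of the h-product\<close>

text \<open>Every quadratic factor splits: the two points i p exp(s) and -i p exp(-s) have sum 2 i p
  sinh s and product p^2.\<close>

lemma h_prod_eq_qpoch_inf:
  assumes "0 < q" "q < 1"
  shows "h_prod (\<i> * of_real (sinh s)) q p
       = qpoch_inf (\<i> * p * of_real (exp s)) q * qpoch_inf (- \<i> * p * of_real (exp (- s))) q"
proof -
  let ?u = "\<i> * p * of_real (exp s)" and ?v = "- \<i> * p * of_real (exp (- s))"
  have e: "complex_of_real (exp s) * of_real (exp (- s)) = 1"
    by (simp flip: of_real_mult exp_add)
  have factor: "1 - 2 * of_real (q ^ k) * p * (\<i> * of_real (sinh s)) + of_real (q ^ (2 * k)) * p ^ 2
      = (1 - ?u * of_real (q ^ k)) * (1 - ?v * of_real (q ^ k))" for k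
  proof -
    have "(1 - ?u * of_real (q ^ k)) * (1 - ?v * of_real (q ^ k))
      = 1 - \<i> * p * of_real (q ^ k) * (of_real (exp s) - of_real (exp (- s)))
        - \<i> * \<i> * (of_real (exp s) * of_real (exp (- s))) * p ^ 2 * of_real (q ^ k) ^ 2"
      by (simp add: algebra_simps power2_eq_square)
    also have "of_real (exp s) - of_real (exp (- s)) = 2 * complex_of_real (sinh s)"
      by (simp add: sinh_field_def)
    finally show ?thesis
      unfolding e by (simp add: power_mult mult_ac flip: power_mult of_real_power)
  qed
  show ?thesis
    unfolding h_prod_def qpoch_inf_def factor
    by (rule prodinf_mult[symmetric]) (rule convergent_prod_qpoch[OF assms])+
qed

section \<open>Integrability\<close>

text \<open>For r at least 0 this is the product of (1 + r exp(\<alpha> t) q^k) (1 + r exp(-\<alpha>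
  t) q^k) over all k, a majorant of |h(i sinh \<alpha> t; p)| for every p with |p| \<le> r.\<close>

definition h_maj :: "real \<Rightarrow> real \<Rightarrow> real \<Rightarrow> real \<Rightarrow> real" where
  "h_maj \<alpha> q r t = norm (qpoch_inf (- of_real (r * exp (\<alpha> * t))) q)
     * norm (qpoch_inf (- of_real (r * exp (- (\<alpha> * t)))) q)"

lemma h_maj_nonneg: "0 \<le> h_maj \<alpha> q r t"
  by (simp add: h_maj_def)

lemma h_maj_minus: "h_maj \<alpha> q r (- t) = h_maj \<alpha> q r t"
  by (simp add: h_maj_def mult.commute)

lemma norm_h_prod_le:
  assumes "0 < q" "q < 1" "norm p \<le> r"
  shows "norm (h_prod (\<i> * of_real (sinh (\<alpha> * t))) q p) \<le> h_maj \<alpha> q r t"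
  unfolding h_prod_eq_qpoch_inf[OF assms(1,2)] h_maj_def norm_mult using assms
  by (intro mult_mono norm_qpoch_inf_le) (auto simp: norm_mult mult_right_mono)

lemma h_maj_le:
  assumes "0 < q" "q < 1" "0 \<le> r" "0 < \<alpha>" "\<bar>t\<bar> \<le> T"
  shows "h_maj \<alpha> q r t \<le> (norm (qpoch_inf (- of_real (r * exp (\<alpha> * T))) q))\<^sup>2"
proof -
  have "\<alpha> * t \<le> \<alpha> * T" "\<alpha> * (- t) \<le> \<alpha> * T"
    using assms by (intro mult_left_mono; linarith)+
  then show ?thesis
    unfolding h_maj_def power2_eq_square using assms
    by (intro mult_mono norm_qpoch_inf_le) (auto simp: norm_mult intro!: mult_left_mono)
qed

text \<open>The translation multiplies exp(\<alpha> t) by exp(2 \<alpha>^2) = 1/q. One product gains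
  exactly the factor 1 + r exp(\<alpha> t)/q; the argument of the other shrinks by q, so its value
  does not grow.\<close>

lemma h_maj_shift:
  assumes "0 < \<alpha>" "q = exp (- 2 * \<alpha> ^ 2)" "0 \<le> r"
  shows "h_maj \<alpha> q r (t + 2 * \<alpha>) \<le> (1 + r * exp (\<alpha> * t) / q) * h_maj \<alpha> q r t"
proof -
  have q: "0 < q" "q < 1" using assms by auto
  have up: "exp (\<alpha> * (t + 2 * \<alpha>)) = exp (\<alpha> * t) / q"
    by (simp add: assms(2) distrib_left exp_add exp_minus divide_inverse power2_eq_square mult_ac)
  have down: "exp (- (\<alpha> * (t + 2 * \<alpha>))) = q * exp (- (\<alpha> * t))"
    by (simp add: assms(2) distrib_left exp_diff exp_minus divide_inverse power2_eq_square mult_ac)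
  have "qpoch_inf (- of_real (r * (exp (\<alpha> * t) / q))) q
      = of_real (1 + r * exp (\<alpha> * t) / q) * qpoch_inf (- of_real (r * exp (\<alpha> * t))) q"
    by (subst qpoch_inf_rec[OF q]) (use q in simp)
  moreover have "\<bar>1 + r * exp (\<alpha> * t) / q\<bar> = 1 + r * exp (\<alpha> * t) / q"
    using assms(3) q by simp
  ultimately have 1: "norm (qpoch_inf (- of_real (r * (exp (\<alpha> * t) / q))) q)
      = (1 + r * exp (\<alpha> * t) / q) * norm (qpoch_inf (- of_real (r * exp (\<alpha> * t))) q)"
    by (simp only: norm_mult norm_of_real)
  have 2: "norm (qpoch_inf (- of_real (r * (q * exp (- (\<alpha> * t))))) q)
      \<le> norm (qpoch_inf (- of_real (r * exp (- (\<alpha> * t)))) q)"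
    using assms(3) q
    by (intro norm_qpoch_inf_le) (auto simp: norm_mult mult_left_mono mult_left_le_one_le)
  show ?thesis
    unfolding h_maj_def up down 1 using assms(3) q 2
    by (auto simp: mult.assoc intro!: mult_left_mono)
qed

lemma borel_measurable_h_maj [measurable]:
  assumes "0 < q" "q < 1"
  shows "h_maj \<alpha> q r \<in> borel_measurable borel"
  unfolding h_maj_def
  by (intro borel_measurable_times borel_measurable_norm[THEN measurable_compose[rotated]]
        borel_measurable_qpoch_inf assms) measurable

lemma borel_measurable_cosh_scaled [measurable]: "(\<lambda>t. cosh (\<alpha> * t :: real)) \<in> borel_measurable borel"
  by (intro borel_measurable_continuous_onI continuous_intros)

text \<open>Finitely many steps of length \<open>\<delta>\<close> to the left bring \<open>t\<close>
  into the period from \<open>T\<close> to \<open>T + \<delta>\<close>, and \<open>G\<close> does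
  not decrease along them.\<close>

lemma bounded_above_if_shift_le:
  fixes G :: "real \<Rightarrow> real"
  assumes "0 < \<delta>" and step: "\<And>t. T \<le> t \<Longrightarrow> G (t + \<delta>) \<le> G t"
    and base: "\<And>t. T \<le> t \<Longrightarrow> t \<le> T + \<delta> \<Longrightarrow> G t \<le> B" and "T \<le> t"
  shows "G t \<le> B"
proof -
  have "G t \<le> B" if "T \<le> t" "t \<le> T + real (Suc n) * \<delta>" for n t
    using that
  proof (induction n arbitrary: t)
    case 0
    then show ?case using base by simp
  next
    case (Suc n)
    show ?case
    proof (cases "t \<le> T + \<delta>")
      case True
      then show ?thesis using base Suc.prems by simp
    next
      case False
      then have "G (t - \<delta>) \<le> B"
        using Suc.prems by (intro Suc.IH) (auto simp: algebra_simps)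
      moreover have "G (t - \<delta> + \<delta>) \<le> G (t - \<delta>)"
        using False by (intro step) simp
      ultimately show ?thesis by simp
    qed
  qed
  moreover obtain n where "(t - T) / \<delta> \<le> real n"
    using real_arch_simple by blast
  then have "t \<le> T + real (Suc n) * \<delta>"
    using assms(1) by (simp add: field_simps)
  ultimately show ?thesis using assms(4) by blast
qed

text \<open>Under \<open>t \<mapsto> t + 2 \<alpha>\<close> the integrand times \<open>1 + t\<^sup>2\<close> is multiplied by at most a factor tending to
  \<open>r1 r2 r3 r4 / q ^ (m + 2) < 1\<close> at infinity, so the product is bounded and the integrand is
  dominated by a multiple of \<open>1 / (1 + t\<^sup>2)\<close>.\<close>

lemma integrable_h_maj:
  assumes "0 < \<alpha>" and q_def: "q = exp (- 2 * \<alpha> ^ 2)"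
    and r: "0 \<le> r1" "0 \<le> r2" "0 \<le> r3" "0 \<le> r4" and small: "r1 * r2 * r3 * r4 < q ^ (m + 2)"
  shows "integrable lborel (\<lambda>t. h_maj \<alpha> q r1 t * h_maj \<alpha> q r2 t * h_maj \<alpha> q r3 t * h_maj \<alpha> q r4 t
           * (exp (- (t ^ 2)) * cosh (\<alpha> * t) ^ m))"
proof -
  have q: "0 < q" "q < 1" using assms by auto
  define H where "H t = h_maj \<alpha> q r1 t * h_maj \<alpha> q r2 t * h_maj \<alpha> q r3 t * h_maj \<alpha> q r4 t" for t
  define E where "E t = H t * (exp (- (t ^ 2)) * cosh (\<alpha> * t) ^ m)" for t
  define G where "G t = E t * (1 + t ^ 2)" for t
  define \<rho> where "\<rho> t = (exp (- (\<alpha> * t)) + r1 / q) * (exp (- (\<alpha> * t)) + r2 / q)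
      * (exp (- (\<alpha> * t)) + r3 / q) * (exp (- (\<alpha> * t)) + r4 / q) * (q ^ 2 / q ^ m)
      * ((1 + (t + 2 * \<alpha>) ^ 2) / (1 + t ^ 2))" for t
  have H_nonneg: "0 \<le> H t" for t
    by (simp add: H_def h_maj_nonneg)
  have E_nonneg: "0 \<le> E t" for t
    by (simp add: E_def H_nonneg)
  have E_minus: "E (- t) = E t" for t
    by (simp add: E_def H_def h_maj_minus)
  have [measurable]: "E \<in> borel_measurable borel"
    unfolding E_def H_def using borel_measurable_h_maj[OF q] by measurable
  have pos: "1 + t ^ 2 > (0::real)" for t
    by (simp add: add_pos_nonneg)

  have E_shift: "E (t + 2 * \<alpha>) \<le> (exp (- (\<alpha> * t)) + r1 / q) * (exp (- (\<alpha> * t)) + r2 / q)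
      * (exp (- (\<alpha> * t)) + r3 / q) * (exp (- (\<alpha> * t)) + r4 / q) * (q ^ 2 / q ^ m) * E t" for t
  proof -
    \<comment> \<open>Pulling exp(\<alpha> t) out of each of the four factors leaves exp(\<alpha>
      t)^4, which the Gaussian cancels: its translate contributes q^2 exp(-4 \<alpha> t). The power
      of cosh costs at most q^(-m).\<close>
    have fac: "1 + r * exp (\<alpha> * t) / q = exp (\<alpha> * t) * (exp (- (\<alpha> * t)) + r / q)" for r
      by (simp add: distrib_left flip: exp_add)
    have "H (t + 2 * \<alpha>) \<le> ((1 + r1 * exp (\<alpha> * t) / q) * h_maj \<alpha> q r1 t)
        * ((1 + r2 * exp (\<alpha> * t) / q) * h_maj \<alpha> q r2 t)
        * ((1 + r3 * exp (\<alpha> * t) / q) * h_maj \<alpha> q r3 t)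
        * ((1 + r4 * exp (\<alpha> * t) / q) * h_maj \<alpha> q r4 t)"
      unfolding H_def using r q
      by (intro mult_mono h_maj_shift assms mult_nonneg_nonneg h_maj_nonneg add_nonneg_nonneg) auto
    also have "\<dots> = (exp (- (\<alpha> * t)) + r1 / q) * (exp (- (\<alpha> * t)) + r2 / q)
      * (exp (- (\<alpha> * t)) + r3 / q) * (exp (- (\<alpha> * t)) + r4 / q) * (exp (\<alpha> * t) ^ 4 * H t)"
      unfolding fac H_def by (simp add: power4_eq_xxxx mult_ac)
    finally have 1: "H (t + 2 * \<alpha>) \<le> \<dots>" .
    have "- ((t + 2 * \<alpha>)\<^sup>2) = - (t\<^sup>2) - 4 * (\<alpha> * t) - 4 * \<alpha>\<^sup>2"
      by (simp add: power2_eq_square algebra_simps)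
    then have "exp (- ((t + 2 * \<alpha>)\<^sup>2)) = exp (- (t\<^sup>2)) * exp (- 4 * (\<alpha> * t)) * exp (- 4 * \<alpha>\<^sup>2)"
      by (simp flip: exp_add)
    moreover have "exp (- 4 * (\<alpha> * t)) = inverse (exp (\<alpha> * t) ^ 4)"
      by (simp flip: exp_minus exp_of_nat_mult)
    moreover have "exp (- 4 * \<alpha>\<^sup>2) = q ^ 2"
      by (simp add: q_def flip: exp_of_nat_mult)
    ultimately have 2: "exp (- ((t + 2 * \<alpha>)\<^sup>2)) = exp (- (t\<^sup>2)) * q ^ 2 / exp (\<alpha> * t) ^ 4"
      by (simp add: divide_inverse mult_ac)
    have "cosh (\<alpha> * (t + 2 * \<alpha>)) \<le> cosh (\<alpha> * t) / q"
    proof -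
      have "exp (\<alpha> * (t + 2 * \<alpha>)) = exp (\<alpha> * t) / q"
        by (simp add: q_def distrib_left exp_add exp_minus divide_inverse power2_eq_square mult_ac)
      moreover have "exp (- (\<alpha> * (t + 2 * \<alpha>))) \<le> exp (- (\<alpha> * t)) / q"
      proof -
        have "exp (- (\<alpha> * (t + 2 * \<alpha>))) \<le> exp (- (\<alpha> * t))"
          using assms(1) by (simp add: distrib_left)
        also have "\<dots> \<le> exp (- (\<alpha> * t)) / q"
          using q by (simp add: field_simps)
        finally show ?thesis .
      qed
      ultimately show ?thesis
        by (simp add: cosh_field_def add_divide_distrib)
    qed
    then have 3: "cosh (\<alpha> * (t + 2 * \<alpha>)) ^ m \<le> cosh (\<alpha> * t) ^ m / q ^ m"
      unfolding power_divide[symmetric] by (intro power_mono) auto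
    have "E (t + 2 * \<alpha>) \<le> ((exp (- (\<alpha> * t)) + r1 / q) * (exp (- (\<alpha> * t)) + r2 / q)
      * (exp (- (\<alpha> * t)) + r3 / q) * (exp (- (\<alpha> * t)) + r4 / q) * (exp (\<alpha> * t) ^ 4 * H t))
      * ((exp (- (t\<^sup>2)) * q ^ 2 / exp (\<alpha> * t) ^ 4) * (cosh (\<alpha> * t) ^ m / q ^ m))"
      unfolding E_def 2 using q 3 r
      by (intro mult_mono 1 mult_nonneg_nonneg H_nonneg add_nonneg_nonneg) auto
    also have "\<dots> = (exp (- (\<alpha> * t)) + r1 / q) * (exp (- (\<alpha> * t)) + r2 / q)
      * (exp (- (\<alpha> * t)) + r3 / q) * (exp (- (\<alpha> * t)) + r4 / q) * (q ^ 2 / q ^ m) * E t"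
      unfolding E_def by simp
    finally show ?thesis .
  qed
  have G_shift: "G (t + 2 * \<alpha>) \<le> \<rho> t * G t" for t
  proof -
    have "\<rho> t * G t = ((exp (- (\<alpha> * t)) + r1 / q) * (exp (- (\<alpha> * t)) + r2 / q)
      * (exp (- (\<alpha> * t)) + r3 / q) * (exp (- (\<alpha> * t)) + r4 / q) * (q ^ 2 / q ^ m) * E t)
      * (1 + (t + 2 * \<alpha>) ^ 2)"
      unfolding \<rho>_def G_def using pos[of t] by simp
    moreover have "G (t + 2 * \<alpha>) \<le> \<dots>"
      unfolding G_def[of "t + 2 * \<alpha>"] using pos[of "t + 2 * \<alpha>"] by (intro mult_right_mono E_shift) simp
    ultimately show ?thesis by simp
  qed
  have e0: "((\<lambda>t. exp (- (\<alpha> * t))) \<longlongrightarrow> 0) at_top"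
    using assms(1) by real_asymp
  have "((\<lambda>t. (1 + (t + 2 * \<alpha>) ^ 2) / (1 + t ^ 2)) \<longlongrightarrow> 1) at_top"
    by real_asymp
  then have "(\<rho> \<longlongrightarrow> (0 + r1 / q) * (0 + r2 / q) * (0 + r3 / q) * (0 + r4 / q) * (q ^ 2 / q ^ m) * 1) at_top"
    unfolding \<rho>_def by (intro tendsto_intros e0)
  moreover have "(0 + r1 / q) * (0 + r2 / q) * (0 + r3 / q) * (0 + r4 / q) * (q ^ 2 / q ^ m) * 1 < 1"
    using small q by (simp add: field_simps power_add power2_eq_square)
  ultimately have "\<forall>\<^sub>F t in at_top. \<rho> t < 1"
    by (rule order_tendstoD)
  then obtain T0 where T0: "\<And>t. T0 \<le> t \<Longrightarrow> \<rho> t < 1"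
    by (auto simp: eventually_at_top_linorder)
  \<comment> \<open>The maximum with 0 keeps the base period on the half line where
    \<open>G_le\<close> applies; negative arguments are reached by evenness.\<close>
  define T where "T = max T0 0"
  have step: "G (t + 2 * \<alpha>) \<le> G t" if "T \<le> t" for t
  proof -
    have "\<rho> t * G t \<le> 1 * G t"
      using T0[of t] that E_nonneg[of t] pos[of t]
      by (intro mult_right_mono) (auto simp: T_def G_def)
    with G_shift[of t] show ?thesis by simp
  qed
  \<comment> \<open>The interval from 0 to \<open>T'\<close> contains both the initial stretch up to
    \<open>T\<close> and one full period after it, so the single constant \<open>B\<close> serves
    both.\<close>
  define T' where "T' = T + 2 * \<alpha>"
  define N where "N r = (norm (qpoch_inf (- of_real (r * exp (\<alpha> * T'))) q))\<^sup>2" for r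
  define B where "B = N r1 * N r2 * N r3 * N r4 * (1 * cosh (\<alpha> * T') ^ m) * (1 + T' ^ 2)"
  have G_le: "G t \<le> B" if "0 \<le> t" "t \<le> T'" for t
  proof -
    have "cosh (\<alpha> * t) \<le> cosh (\<alpha> * T')"
      using that assms(1) by (intro cosh_real_nonneg_le_iff[THEN iffD2]) auto
    then show ?thesis
      unfolding G_def E_def H_def B_def N_def using that assms(1) q r
      by (intro mult_mono power_mono h_maj_le add_mono mult_nonneg_nonneg h_maj_nonneg) auto
  qed
  have "G t \<le> B" if "0 \<le> t" for t
  proof (cases "T \<le> t")
    case True
    show ?thesis
      by (rule bounded_above_if_shift_le[of "2 * \<alpha>" T G, OF _ step _ True])
        (use assms(1) G_le in \<open>auto simp: T_def T'_def\<close>)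
  next
    case False
    then show ?thesis using that assms(1) by (intro G_le) (auto simp: T'_def)
  qed
  moreover have "G \<bar>t\<bar> = G t" for t
    using E_minus[of t] by (simp add: G_def abs_if)
  ultimately have "G t \<le> B" for t
    by (metis abs_ge_zero)
  then have bound: "E t \<le> B * inverse (1 + t ^ 2)" for t
    using pos[of t] unfolding G_def by (simp add: field_simps)
  have "integrable lborel (\<lambda>t. inverse (1 + t ^ 2) :: real)"
    using integrable_inverse_1_plus_square by (simp add: set_integrable_def)
  then have "integrable lborel (\<lambda>t. B * inverse (1 + t ^ 2))"
    by simp
  then have "integrable lborel E"
    by (rule Bochner_Integration.integrable_bound) (use bound E_nonneg in \<open>auto intro!: order_trans[OF bound]\<close>)
  then show ?thesis
    unfolding E_def H_def .
qed

lemma h_prods_4: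
  "h_prods z q [a, b, c, d] = h_prod z q a * h_prod z q b * h_prod z q c * h_prod z q d"
  by (simp add: h_prods_def mult.assoc)

lemma norm_h_prods_le:
  assumes "0 < q" "q < 1" "norm a \<le> r1" "norm b \<le> r2" "norm c \<le> r3" "norm d \<le> r4"
  shows "norm (h_prods (\<i> * of_real (sinh (\<alpha> * t))) q [a, b, c, d])
    \<le> h_maj \<alpha> q r1 t * h_maj \<alpha> q r2 t * h_maj \<alpha> q r3 t * h_maj \<alpha> q r4 t"
  unfolding h_prods_4 norm_mult
  by (intro mult_mono norm_h_prod_le assms mult_nonneg_nonneg h_maj_nonneg norm_ge_zero)

lemma borel_measurable_h_prod [measurable]:
  assumes "0 < q" "q < 1"
  shows "(\<lambda>t. h_prod (\<i> * of_real (sinh (\<alpha> * t))) q p) \<in> borel_measurable borel"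
  unfolding h_prod_eq_qpoch_inf[OF assms]
  by (intro borel_measurable_times borel_measurable_qpoch_inf assms) measurable

text \<open>Domination by \<open>h_maj\<close> at the moduli of the parameters. The exponent
  \<open>m\<close> covers both functions needed: the weight itself (m = 1) and the function whose
  translates appear in the difference equation (m = 0), with different smallness conditions.\<close>

lemma integrable_h_prods:
  assumes "0 < \<alpha>" "q = exp (- 2 * \<alpha> ^ 2)" "norm (a * b * c * d) < q ^ (m + 2)"
  shows "integrable lborel (\<lambda>t. h_prods (\<i> * of_real (sinh (\<alpha> * t))) q [a, b, c, d]
           * of_real (exp (- (t ^ 2)) * cosh (\<alpha> * t) ^ m))"
proof (rule Bochner_Integration.integrable_bound)
  have q: "0 < q" "q < 1" using assms by auto
  note [measurable] = borel_measurable_h_prod[OF q]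
  show "integrable lborel (\<lambda>t. h_maj \<alpha> q (norm a) t * h_maj \<alpha> q (norm b) t * h_maj \<alpha> q (norm c) t
      * h_maj \<alpha> q (norm d) t * (exp (- (t ^ 2)) * cosh (\<alpha> * t) ^ m))"
    using assms by (intro integrable_h_maj) (auto simp: norm_mult)
  show "(\<lambda>t. h_prods (\<i> * of_real (sinh (\<alpha> * t))) q [a, b, c, d]
           * of_real (exp (- (t ^ 2)) * cosh (\<alpha> * t) ^ m)) \<in> borel_measurable lborel"
    unfolding h_prods_4 by measurable
  show "AE t in lborel. norm (h_prods (\<i> * of_real (sinh (\<alpha> * t))) q [a, b, c, d]
           * of_real (exp (- (t ^ 2)) * cosh (\<alpha> * t) ^ m))
      \<le> norm (h_maj \<alpha> q (norm a) t * h_maj \<alpha> q (norm b) t * h_maj \<alpha> q (norm c) t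
      * h_maj \<alpha> q (norm d) t * (exp (- (t ^ 2)) * cosh (\<alpha> * t) ^ m))"
  proof (rule AE_I2)
    fix t
    let ?M = "h_maj \<alpha> q (norm a) t * h_maj \<alpha> q (norm b) t * h_maj \<alpha> q (norm c) t * h_maj \<alpha> q (norm d) t"
    let ?w = "exp (- (t ^ 2)) * cosh (\<alpha> * t) ^ m"
    have w: "0 \<le> ?w" by simp
    have "norm (h_prods (\<i> * of_real (sinh (\<alpha> * t))) q [a, b, c, d] * of_real ?w)
       = norm (h_prods (\<i> * of_real (sinh (\<alpha> * t))) q [a, b, c, d]) * ?w"
      using w by (simp only: norm_mult norm_of_real abs_of_nonneg)
    also have "\<dots> \<le> ?M * ?w"
      using w by (intro mult_right_mono norm_h_prods_le q) auto
    also have "\<dots> \<le> norm (?M * ?w)" by simp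
    finally show "norm (h_prods (\<i> * of_real (sinh (\<alpha> * t))) q [a, b, c, d] * of_real ?w)
       \<le> norm (?M * ?w)" .
  qed
qed

lemma integrable_h_weight:
  assumes "0 < \<alpha>" "q = exp (- 2 * \<alpha> ^ 2)" "norm (a * b * c * d) < q ^ 3"
  shows "integrable lborel (h_weight \<alpha> q [a, b, c, d])"
  using integrable_h_prods[of \<alpha> q a b c d 1] assms
  unfolding h_weight_def[abs_def] by (simp add: eval_nat_numeral)

section \<open>The q-beta integral\<close>

text \<open>With the parameter scaled by exp(\<alpha>^2) = q^(-1/2), translation by \<alpha> or
  -\<alpha> changes one of the two arguments of the factorised product by exactly 1/q and leaves the
  other fixed. \<open>qpoch_inf_rec\<close> then splits off one factor.\<close>

lemma h_prod_shift:
  assumes "0 < \<alpha>" "q = exp (- 2 * \<alpha> ^ 2)"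
  shows "h_prod (\<i> * of_real (sinh (\<alpha> * (t + \<alpha>)))) q (p * of_real (exp (\<alpha> ^ 2)))
       = (1 - \<i> * p / of_real q * of_real (exp (\<alpha> * t))) * h_prod (\<i> * of_real (sinh (\<alpha> * t))) q p"
    and "h_prod (\<i> * of_real (sinh (\<alpha> * (t - \<alpha>)))) q (p * of_real (exp (\<alpha> ^ 2)))
       = (1 + \<i> * p / of_real q * of_real (exp (- (\<alpha> * t)))) * h_prod (\<i> * of_real (sinh (\<alpha> * t))) q p"
proof -
  have q: "0 < q" "q < 1" using assms by auto
  have e: "exp (\<alpha> ^ 2) * exp (\<alpha> ^ 2) = 1 / q"
    by (simp add: assms(2) exp_minus inverse_eq_divide flip: exp_add)
  have "exp (\<alpha> ^ 2) * exp (\<alpha> * (t + \<alpha>)) = exp (\<alpha> ^ 2) * exp (\<alpha> ^ 2) * exp (\<alpha> * t)"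
    "exp (\<alpha> ^ 2) * exp (- (\<alpha> * (t - \<alpha>))) = exp (\<alpha> ^ 2) * exp (\<alpha> ^ 2) * exp (- (\<alpha> * t))"
    by (simp_all add: algebra_simps power2_eq_square flip: exp_add)
  then have e1: "exp (\<alpha> ^ 2) * exp (\<alpha> * (t + \<alpha>)) = exp (\<alpha> * t) / q"
    "exp (\<alpha> ^ 2) * exp (- (\<alpha> * (t - \<alpha>))) = exp (- (\<alpha> * t)) / q"
    unfolding e by simp_all
  have e2: "exp (\<alpha> ^ 2) * exp (- (\<alpha> * (t + \<alpha>))) = exp (- (\<alpha> * t))"
    "exp (\<alpha> ^ 2) * exp (\<alpha> * (t - \<alpha>)) = exp (\<alpha> * t)"
    by (simp_all add: algebra_simps power2_eq_square flip: exp_add)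
  note [simp del] = of_real_mult of_real_divide
  show "h_prod (\<i> * of_real (sinh (\<alpha> * (t + \<alpha>)))) q (p * of_real (exp (\<alpha> ^ 2)))
       = (1 - \<i> * p / of_real q * of_real (exp (\<alpha> * t))) * h_prod (\<i> * of_real (sinh (\<alpha> * t))) q p"
  proof -
    have "h_prod (\<i> * of_real (sinh (\<alpha> * (t + \<alpha>)))) q (p * of_real (exp (\<alpha> ^ 2)))
       = qpoch_inf (\<i> * p * of_real (exp (\<alpha> ^ 2) * exp (\<alpha> * (t + \<alpha>)))) q
       * qpoch_inf (- \<i> * p * of_real (exp (\<alpha> ^ 2) * exp (- (\<alpha> * (t + \<alpha>))))) q"
      unfolding h_prod_eq_qpoch_inf[OF q] by (simp add: of_real_mult mult.assoc)
    also have "qpoch_inf (\<i> * p * of_real (exp (\<alpha> ^ 2) * exp (\<alpha> * (t + \<alpha>)))) q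
        = (1 - \<i> * p / of_real q * of_real (exp (\<alpha> * t))) * qpoch_inf (\<i> * p * of_real (exp (\<alpha> * t))) q"
      unfolding e1 by (subst qpoch_inf_rec[OF q]) (use q in \<open>simp add: of_real_divide\<close>)
    finally show ?thesis
      unfolding e2 h_prod_eq_qpoch_inf[OF q] by simp
  qed
  show "h_prod (\<i> * of_real (sinh (\<alpha> * (t - \<alpha>)))) q (p * of_real (exp (\<alpha> ^ 2)))
       = (1 + \<i> * p / of_real q * of_real (exp (- (\<alpha> * t)))) * h_prod (\<i> * of_real (sinh (\<alpha> * t))) q p"
  proof -
    have "h_prod (\<i> * of_real (sinh (\<alpha> * (t - \<alpha>)))) q (p * of_real (exp (\<alpha> ^ 2)))
       = qpoch_inf (\<i> * p * of_real (exp (\<alpha> ^ 2) * exp (\<alpha> * (t - \<alpha>)))) q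
       * qpoch_inf (- \<i> * p * of_real (exp (\<alpha> ^ 2) * exp (- (\<alpha> * (t - \<alpha>))))) q"
      unfolding h_prod_eq_qpoch_inf[OF q] by (simp add: of_real_mult mult.assoc)
    also have "qpoch_inf (- \<i> * p * of_real (exp (\<alpha> ^ 2) * exp (- (\<alpha> * (t - \<alpha>))))) q
        = (1 + \<i> * p / of_real q * of_real (exp (- (\<alpha> * t)))) * qpoch_inf (- \<i> * p * of_real (exp (- (\<alpha> * t)))) q"
      unfolding e1 by (subst qpoch_inf_rec[OF q]) (use q in \<open>simp add: of_real_divide\<close>)
    finally show ?thesis
      unfolding e2 h_prod_eq_qpoch_inf[OF q] by simp
  qed
qed

lemma h_prod_mult_q:
  assumes "0 < q" "q < 1"
  shows "h_prod (\<i> * of_real (sinh s)) q p = (1 - \<i> * p * of_real (exp s)) * (1 + \<i> * p * of_real (exp (- s)))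
      * h_prod (\<i> * of_real (sinh s)) q (p * of_real q)"
  unfolding h_prod_eq_qpoch_inf[OF assms]
  using qpoch_inf_rec[OF assms, of "\<i> * p * of_real (exp s)"]
    qpoch_inf_rec[OF assms, of "- \<i> * p * of_real (exp (- s))"]
  by (simp add: mult_ac)

text \<open>By \<open>h_prod_shift\<close>, both translates of \<open>f\<close> are h(aq, b, c, d)
  exp(-t^2) times a Laurent polynomial in exp(\<alpha> t). The extra \<open>q\<close> in the first
  parameter of \<open>f\<close> makes that common factor the one of the second weight. What remains
  is a polynomial identity.\<close>

lemma h_weight_q_difference:
  fixes a b c d :: complex
  assumes "0 < \<alpha>" "q = exp (- 2 * \<alpha> ^ 2)"
  defines "s \<equiv> exp (\<alpha> ^ 2)"
  defines "f \<equiv> \<lambda>t. h_prods (\<i> * of_real (sinh (\<alpha> * t))) q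
      [a * of_real q * of_real s, b * of_real s, c * of_real s, d * of_real s] * of_real (exp (- (t ^ 2)))"
  shows "(1 - a * b * c * d / of_real (q ^ 3)) * h_weight \<alpha> q [a, b, c, d] t
      - (1 - a * b / of_real q) * (1 - a * c / of_real q) * (1 - a * d / of_real q)
        * h_weight \<alpha> q [a * of_real q, b, c, d] t
      = \<i> * a * of_real s / 2 * (f (t + \<alpha>) - f (t - \<alpha>))"
proof -
  have q: "0 < q" "q < 1" using assms by auto
  define z w where "z = complex_of_real (exp (\<alpha> * t))" and "w = complex_of_real (exp (- (\<alpha> * t)))"
  define Q where "Q = complex_of_real q"
  define \<beta> \<gamma> \<delta> where "\<beta> = b / Q" and "\<gamma> = c / Q" and "\<delta> = d / Q"
  define X where "X = h_prods (\<i> * of_real (sinh (\<alpha> * t))) q [a * Q, b, c, d] * of_real (exp (- (t ^ 2)))"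
  have Q0: "Q \<noteq> 0" using q by (simp add: Q_def)
  have zw: "z * w = 1" by (simp add: z_def w_def flip: of_real_mult exp_add)
  \<comment> \<open>One factor \<open>s\<close> absorbs the exp(-\<alpha>^2) from the translated
    Gaussian.\<close>
  have ss: "complex_of_real (s * exp (- ((t + \<alpha>) ^ 2))) = of_real (exp (- (t ^ 2))) * w ^ 2"
    "complex_of_real (s * exp (- ((t - \<alpha>) ^ 2))) = of_real (exp (- (t ^ 2))) * z ^ 2"
    by (simp_all add: s_def z_def w_def power2_eq_square algebra_simps flip: of_real_mult exp_add)
  have f1: "of_real s * f (t + \<alpha>)
      = X * w ^ 2 * (1 - \<i> * a * z) * (1 - \<i> * \<beta> * z) * (1 - \<i> * \<gamma> * z) * (1 - \<i> * \<delta> * z)"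
  proof -
    have "of_real s * f (t + \<alpha>) = h_prods (\<i> * of_real (sinh (\<alpha> * (t + \<alpha>)))) q
      [a * of_real q * of_real s, b * of_real s, c * of_real s, d * of_real s]
      * of_real (s * exp (- ((t + \<alpha>) ^ 2)))"
      by (simp add: f_def)
    also have "\<dots> = X * w ^ 2 * (1 - \<i> * a * z) * (1 - \<i> * \<beta> * z) * (1 - \<i> * \<gamma> * z) * (1 - \<i> * \<delta> * z)"
      unfolding ss unfolding s_def h_prods_4 h_prod_shift[OF assms(1,2)] X_def
      using Q0 by (simp add: Q_def[symmetric] \<beta>_def \<gamma>_def \<delta>_def z_def[symmetric])
    finally show ?thesis .
  qed
  have f2: "of_real s * f (t - \<alpha>)
      = X * z ^ 2 * (1 + \<i> * a * w) * (1 + \<i> * \<beta> * w) * (1 + \<i> * \<gamma> * w) * (1 + \<i> * \<delta> * w)"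
  proof -
    have "of_real s * f (t - \<alpha>) = h_prods (\<i> * of_real (sinh (\<alpha> * (t - \<alpha>)))) q
      [a * of_real q * of_real s, b * of_real s, c * of_real s, d * of_real s]
      * of_real (s * exp (- ((t - \<alpha>) ^ 2)))"
      by (simp add: f_def)
    also have "\<dots> = X * z ^ 2 * (1 + \<i> * a * w) * (1 + \<i> * \<beta> * w) * (1 + \<i> * \<gamma> * w) * (1 + \<i> * \<delta> * w)"
      unfolding ss unfolding s_def h_prods_4 h_prod_shift[OF assms(1,2)] X_def
      using Q0 by (simp add: Q_def[symmetric] \<beta>_def \<gamma>_def \<delta>_def w_def[symmetric])
    finally show ?thesis .
  qed
  have cosh: "complex_of_real (cosh (\<alpha> * t)) = (z + w) / 2"
    by (simp add: cosh_field_def z_def w_def)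
  have h1: "h_weight \<alpha> q [a * of_real q, b, c, d] t = X * ((z + w) / 2)"
    unfolding h_weight_def X_def of_real_mult cosh by (simp add: Q_def)
  have h0: "h_weight \<alpha> q [a, b, c, d] t = (1 - \<i> * a * z) * (1 + \<i> * a * w) * (X * ((z + w) / 2))"
    unfolding h_weight_def X_def of_real_mult cosh h_prods_4
    by (subst h_prod_mult_q[OF q]) (simp add: Q_def z_def w_def)
  \<comment> \<open>The whole claim with the common factor \<open>X / 2\<close> removed; it holds
    modulo the relations zw = 1 and i^2 = -1.\<close>
  have "(1 - a * \<beta> * \<gamma> * \<delta>) * ((1 - \<i> * a * z) * (1 + \<i> * a * w) * (z + w))
      - (1 - a * \<beta>) * (1 - a * \<gamma>) * (1 - a * \<delta>) * (z + w)
      = \<i> * a * (w ^ 2 * (1 - \<i> * a * z) * (1 - \<i> * \<beta> * z) * (1 - \<i> * \<gamma> * z) * (1 - \<i> * \<delta> * z)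
         - z ^ 2 * (1 + \<i> * a * w) * (1 + \<i> * \<beta> * w) * (1 + \<i> * \<gamma> * w) * (1 + \<i> * \<delta> * w))"
    using zw i_squared by algebra
  then have "X / 2 * ((1 - a * \<beta> * \<gamma> * \<delta>) * ((1 - \<i> * a * z) * (1 + \<i> * a * w) * (z + w))
      - (1 - a * \<beta>) * (1 - a * \<gamma>) * (1 - a * \<delta>) * (z + w))
     = X / 2 * (\<i> * a * (w ^ 2 * (1 - \<i> * a * z) * (1 - \<i> * \<beta> * z) * (1 - \<i> * \<gamma> * z) * (1 - \<i> * \<delta> * z)
         - z ^ 2 * (1 + \<i> * a * w) * (1 + \<i> * \<beta> * w) * (1 + \<i> * \<gamma> * w) * (1 + \<i> * \<delta> * w)))"
    by simp
  also have "\<dots> = \<i> * a / 2 * (of_real s * f (t + \<alpha>) - of_real s * f (t - \<alpha>))"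
    unfolding f1 f2 by (simp add: algebra_simps)
  also have "\<dots> = \<i> * a * of_real s / 2 * (f (t + \<alpha>) - f (t - \<alpha>))"
    by (simp add: algebra_simps)
  finally have *: "X / 2 * ((1 - a * \<beta> * \<gamma> * \<delta>) * ((1 - \<i> * a * z) * (1 + \<i> * a * w) * (z + w))
      - (1 - a * \<beta>) * (1 - a * \<gamma>) * (1 - a * \<delta>) * (z + w)) = \<dots>" .
  have "a * b * c * d / of_real (q ^ 3) = a * \<beta> * \<gamma> * \<delta>"
    by (simp add: \<beta>_def \<gamma>_def \<delta>_def Q_def power3_eq_cube)
  moreover have "a * b / of_real q = a * \<beta>" "a * c / of_real q = a * \<gamma>" "a * d / of_real q = a * \<delta>"
    by (simp_all add: \<beta>_def \<gamma>_def \<delta>_def Q_def)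
  moreover have "K * (A * B * (X * ((z + w) / 2))) - L * (X * ((z + w) / 2))
      = X / 2 * (K * (A * B * (z + w)) - L * (z + w))" for K A B L
    by (simp add: field_simps)
  ultimately show ?thesis
    unfolding h0 h1 *[symmetric] by (simp only:)
qed

section \<open>The integrated q-difference equation and its iteration\<close>

lemma integral_shift:
  fixes f :: "real \<Rightarrow> complex"
  shows "(LBINT t. f (t + c)) = (LBINT t. f t)"
  using lborel_integral_real_affine[of 1 f c] by (simp add: add.commute)

lemma integrable_shift:
  fixes f :: "real \<Rightarrow> complex"
  assumes "integrable lborel f"
  shows "integrable lborel (\<lambda>t. f (t + c))"
  using lborel_integrable_real_affine[OF assms, of 1 c] by (simp add: add.commute)

definition h_integral :: "real \<Rightarrow> real \<Rightarrow> complex \<Rightarrow> complex \<Rightarrow> complex \<Rightarrow> complex \<Rightarrow> complex" where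
  "h_integral \<alpha> q a b c d = (LBINT t. h_weight \<alpha> q [a, b, c, d] t)"

text \<open>Exchanges the first parameter with each of the others, so that results about the first
  parameter apply to all four.\<close>

lemma h_weight_permute:
  "h_weight \<alpha> q [b, a, c, d] = h_weight \<alpha> q [a, b, c, d]"
  "h_weight \<alpha> q [c, b, a, d] = h_weight \<alpha> q [a, b, c, d]"
  "h_weight \<alpha> q [d, b, c, a] = h_weight \<alpha> q [a, b, c, d]"
  by (simp_all add: h_weight_def h_prods_def fun_eq_iff)

text \<open>Integration of \<open>h_weight_q_difference\<close>: its right-hand side is a multiple
  of the difference of two translates of one integrable function, so it integrates to 0.\<close>

lemma h_integral_q_difference:
  assumes "0 < \<alpha>" "q = exp (- 2 * \<alpha> ^ 2)" "norm (a * b * c * d) < q ^ 3"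
  shows "(1 - a * b * c * d / of_real (q ^ 3)) * h_integral \<alpha> q a b c d
       = (1 - a * b / of_real q) * (1 - a * c / of_real q) * (1 - a * d / of_real q)
         * h_integral \<alpha> q (a * of_real q) b c d"
proof -
  have q: "0 < q" "q < 1" using assms by auto
  define s where "s = exp (\<alpha> ^ 2)"
  define f where "f t = h_prods (\<i> * of_real (sinh (\<alpha> * t))) q
      [a * of_real q * of_real s, b * of_real s, c * of_real s, d * of_real s] * of_real (exp (- (t ^ 2)))" for t
  \<comment> \<open>Since s = q^(-1/2), the parameters of \<open>f\<close> have product abcd s^4 q =
    abcd/q. The hypothesis |abcd| < q^3 thus becomes the bound q^2 required for m = 0.\<close>
  have "s ^ 4 * q ^ 2 = 1"
    by (simp add: s_def assms(2) flip: exp_of_nat_mult exp_add)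
  then have s4: "s ^ 4 * q ^ 3 = q"
    by (simp add: eval_nat_numeral)
  have "norm (a * of_real q * of_real s * (b * of_real s) * (c * of_real s) * (d * of_real s))
      = norm (a * b * c * d) * (s ^ 4 * q)"
    using q by (simp add: norm_mult s_def power4_eq_xxxx)
  also have "\<dots> < q ^ 3 * (s ^ 4 * q)"
    using assms(3) q by (intro mult_strict_right_mono) (auto simp: s_def)
  also have "\<dots> = q ^ 2"
    using s4 by (simp add: power2_eq_square mult_ac)
  finally have f: "integrable lborel f"
    using integrable_h_prods[OF assms(1,2), of "a * of_real q * of_real s" "b * of_real s"
        "c * of_real s" "d * of_real s" 0]
    by (simp add: f_def[abs_def] power2_eq_square)
  have 0: "integrable lborel (h_weight \<alpha> q [a, b, c, d])"
    using assms by (intro integrable_h_weight) auto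
  have "norm (a * of_real q * b * c * d) \<le> norm (a * b * c * d) * 1"
    using q by (simp add: norm_mult mult_left_le_one_le mult_ac)
  then have 1: "integrable lborel (h_weight \<alpha> q [a * of_real q, b, c, d])"
    using assms by (intro integrable_h_weight) auto
  have "(1 - a * b * c * d / of_real (q ^ 3)) * h_integral \<alpha> q a b c d
      - (1 - a * b / of_real q) * (1 - a * c / of_real q) * (1 - a * d / of_real q)
         * h_integral \<alpha> q (a * of_real q) b c d
      = (LBINT t. (1 - a * b * c * d / of_real (q ^ 3)) * h_weight \<alpha> q [a, b, c, d] t
      - (1 - a * b / of_real q) * (1 - a * c / of_real q) * (1 - a * d / of_real q)
        * h_weight \<alpha> q [a * of_real q, b, c, d] t)"
    unfolding h_integral_def using 0 1 by simp
  also have "\<dots> = (LBINT t. \<i> * a * of_real s / 2 * (f (t + \<alpha>) - f (t - \<alpha>)))"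
    unfolding h_weight_q_difference[OF assms(1,2)] f_def s_def ..
  also have "\<dots> = 0"
    using integral_shift[of f \<alpha>] integral_shift[of f "- \<alpha>"]
      integrable_shift[OF f, of \<alpha>] integrable_shift[OF f, of "- \<alpha>"] by simp
  finally show ?thesis by simp
qed

text \<open>Iterates the difference equation along a, aq, ..., aq^(n-1); the smallness condition
  persists as the modulus of the first parameter only shrinks. It serves for n tending to infinity
  and, at finite n, for the terms of the terminating series.\<close>

lemma h_integral_qpoch:
  assumes "0 < \<alpha>" "q = exp (- 2 * \<alpha> ^ 2)" "norm (a * b * c * d) < q ^ 3"
  shows "qpoch (a * b * c * d / of_real (q ^ 3)) q n * h_integral \<alpha> q a b c d
       = qpoch (a * b / of_real q) q n * qpoch (a * c / of_real q) q n * qpoch (a * d / of_real q) q n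
         * h_integral \<alpha> q (a * of_real (q ^ n)) b c d"
proof (induction n)
  case (Suc n)
  have q: "0 < q" "q < 1" using assms by auto
  let ?a = "a * of_real (q ^ n)"
  have "norm (?a * b * c * d) = norm (a * b * c * d) * q ^ n"
    using q by (simp add: norm_mult norm_power mult_ac)
  also have "\<dots> \<le> norm (a * b * c * d) * 1"
    using q by (intro mult_left_mono power_le_one) auto
  finally have "norm (?a * b * c * d) < q ^ 3"
    using assms(3) by simp
  from h_integral_q_difference[OF assms(1,2) this]
  have *: "(1 - a * b * c * d / of_real (q ^ 3) * of_real (q ^ n)) * h_integral \<alpha> q ?a b c d
     = (1 - a * b / of_real q * of_real (q ^ n)) * (1 - a * c / of_real q * of_real (q ^ n))
       * (1 - a * d / of_real q * of_real (q ^ n)) * h_integral \<alpha> q (a * of_real (q ^ Suc n)) b c d"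
    by (simp add: mult_ac)
  have "qpoch (a * b * c * d / of_real (q ^ 3)) q (Suc n) * h_integral \<alpha> q a b c d
     = (1 - a * b * c * d / of_real (q ^ 3) * of_real (q ^ n))
        * (qpoch (a * b * c * d / of_real (q ^ 3)) q n * h_integral \<alpha> q a b c d)"
    unfolding qpoch_Suc by (simp only: mult_ac)
  also have "\<dots> = qpoch (a * b / of_real q) q n * qpoch (a * c / of_real q) q n * qpoch (a * d / of_real q) q n
      * ((1 - a * b * c * d / of_real (q ^ 3) * of_real (q ^ n)) * h_integral \<alpha> q ?a b c d)"
    unfolding Suc.IH by (simp only: mult_ac)
  also have "\<dots> = qpoch (a * b / of_real q) q (Suc n) * qpoch (a * c / of_real q) q (Suc n)
      * qpoch (a * d / of_real q) q (Suc n) * h_integral \<alpha> q (a * of_real (q ^ Suc n)) b c d"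
    unfolding * qpoch_Suc by (simp only: mult_ac)
  finally show ?case .
qed simp

text \<open>Dominated convergence: the majorant at |a| works for all a q^n at once, and the
  h-product of a q^n tends to 1 pointwise.\<close>

lemma h_integral_tendsto:
  assumes "0 < \<alpha>" "q = exp (- 2 * \<alpha> ^ 2)" "norm (a * b * c * d) < q ^ 3"
  shows "(\<lambda>n. h_integral \<alpha> q (a * of_real (q ^ n)) b c d) \<longlonglongrightarrow> h_integral \<alpha> q 0 b c d"
  unfolding h_integral_def
proof (rule integral_dominated_convergence)
  have q: "0 < q" "q < 1" using assms by auto
  note [measurable] = borel_measurable_h_prod[OF q]
  show "h_weight \<alpha> q [0, b, c, d] \<in> borel_measurable lborel"
    "\<And>n. h_weight \<alpha> q [a * of_real (q ^ n), b, c, d] \<in> borel_measurable lborel"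
    unfolding h_weight_def h_prods_4 by measurable
  show "integrable lborel (\<lambda>t. h_maj \<alpha> q (norm a) t * h_maj \<alpha> q (norm b) t * h_maj \<alpha> q (norm c) t
      * h_maj \<alpha> q (norm d) t * (exp (- (t ^ 2)) * cosh (\<alpha> * t) ^ 1))"
    using assms by (intro integrable_h_maj) (auto simp: norm_mult eval_nat_numeral)
  have lim: "(\<lambda>n. x * (a * of_real (q ^ n)) * y) \<longlonglongrightarrow> 0" for x y
  proof -
    have "(\<lambda>n. x * (a * of_real (q ^ n)) * y) \<longlonglongrightarrow> x * (a * of_real 0) * y"
      using q by (intro tendsto_intros LIMSEQ_realpow_zero) auto
    then show ?thesis by simp
  qed
  have "(\<lambda>n. h_weight \<alpha> q [a * of_real (q ^ n), b, c, d] t) \<longlonglongrightarrow> h_weight \<alpha> q [0, b, c, d] t" for t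
  proof -
    have "(\<lambda>n. h_prod (\<i> * of_real (sinh (\<alpha> * t))) q (a * of_real (q ^ n))) \<longlonglongrightarrow> 1 * 1"
      unfolding h_prod_eq_qpoch_inf[OF q] by (intro tendsto_mult qpoch_inf_tendsto_1[OF q] lim)
    moreover have "h_prod (\<i> * of_real (sinh (\<alpha> * t))) q 0 = 1 * 1"
      unfolding h_prod_eq_qpoch_inf[OF q] by simp
    ultimately show ?thesis
      unfolding h_weight_def h_prods_4 by (intro tendsto_mult tendsto_const) simp
  qed
  then show "AE t in lborel. (\<lambda>n. h_weight \<alpha> q [a * of_real (q ^ n), b, c, d] t)
      \<longlonglongrightarrow> h_weight \<alpha> q [0, b, c, d] t"
    by simp
  fix n
  show "AE t in lborel. norm (h_weight \<alpha> q [a * of_real (q ^ n), b, c, d] t)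
      \<le> h_maj \<alpha> q (norm a) t * h_maj \<alpha> q (norm b) t * h_maj \<alpha> q (norm c) t
      * h_maj \<alpha> q (norm d) t * (exp (- (t ^ 2)) * cosh (\<alpha> * t) ^ 1)"
  proof (rule AE_I2)
    fix t
    let ?w = "exp (- (t ^ 2)) * cosh (\<alpha> * t)"
    have w: "0 \<le> ?w" by simp
    have "norm a * q ^ n \<le> norm a * 1"
      using q by (intro mult_left_mono power_le_one) auto
    then have "norm (a * of_real (q ^ n)) \<le> norm a"
      using q by (simp add: norm_mult norm_power)
    then have "norm (h_prods (\<i> * of_real (sinh (\<alpha> * t))) q [a * of_real (q ^ n), b, c, d]) * ?w
      \<le> h_maj \<alpha> q (norm a) t * h_maj \<alpha> q (norm b) t * h_maj \<alpha> q (norm c) t * h_maj \<alpha> q (norm d) t * ?w"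
      using w by (intro mult_right_mono norm_h_prods_le q) auto
    then show "norm (h_weight \<alpha> q [a * of_real (q ^ n), b, c, d] t)
      \<le> h_maj \<alpha> q (norm a) t * h_maj \<alpha> q (norm b) t * h_maj \<alpha> q (norm c) t
      * h_maj \<alpha> q (norm d) t * (exp (- (t ^ 2)) * cosh (\<alpha> * t) ^ 1)"
      unfolding h_weight_def using w by (simp only: norm_mult norm_of_real abs_of_nonneg power_one_right)
  qed
qed

lemma h_integral_remove:
  assumes "0 < \<alpha>" "q = exp (- 2 * \<alpha> ^ 2)" "norm (a * b * c * d) < q ^ 3"
  shows "qpoch_inf (a * b * c * d / of_real (q ^ 3)) q * h_integral \<alpha> q a b c d
       = qpoch_inf (a * b / of_real q) q * qpoch_inf (a * c / of_real q) q * qpoch_inf (a * d / of_real q) q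
         * h_integral \<alpha> q 0 b c d"
proof (rule LIMSEQ_unique)
  have q: "0 < q" "q < 1" using assms by auto
  show "(\<lambda>n. qpoch (a * b * c * d / of_real (q ^ 3)) q n * h_integral \<alpha> q a b c d)
    \<longlonglongrightarrow> qpoch_inf (a * b * c * d / of_real (q ^ 3)) q * h_integral \<alpha> q a b c d"
    by (intro tendsto_intros qpoch_LIMSEQ q)
  show "(\<lambda>n. qpoch (a * b * c * d / of_real (q ^ 3)) q n * h_integral \<alpha> q a b c d)
    \<longlonglongrightarrow> qpoch_inf (a * b / of_real q) q * qpoch_inf (a * c / of_real q) q * qpoch_inf (a * d / of_real q) q
         * h_integral \<alpha> q 0 b c d"
    unfolding h_integral_qpoch[OF assms]
    by (intro tendsto_intros qpoch_LIMSEQ q h_integral_tendsto assms)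
qed

section \<open>Evaluation of the integral\<close>

text \<open>Completing the square turns the integrand into a multiple of the sum of two normal
  densities with variance 1/2 and means \<alpha>/2 and -\<alpha>/2.\<close>

lemma gaussian_cosh_integral:
  "(LBINT t. exp (- (t ^ 2)) * cosh (\<alpha> * t)) = sqrt pi * exp (\<alpha> ^ 2 / 4)"
proof -
  have n: "normal_density \<mu> (1 / sqrt 2) t = exp (- ((t - \<mu>) ^ 2)) / sqrt pi" for \<mu> t
    by (simp add: normal_density_def power_divide)
  have e: "exp (- (t ^ 2)) * cosh (\<alpha> * t)
     = (sqrt pi * exp (\<alpha> ^ 2 / 4) / 2)
        * (normal_density (\<alpha> / 2) (1 / sqrt 2) t + normal_density (- \<alpha> / 2) (1 / sqrt 2) t)" for t
  proof -
    have "exp (- (t ^ 2)) * exp (\<beta> * t) = exp (\<beta> ^ 2 / 4) * exp (- ((t - \<beta> / 2) ^ 2))" for \<beta>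
      by (simp add: power2_eq_square field_simps flip: exp_add)
    from this[of \<alpha>] this[of "- \<alpha>"] show ?thesis
      unfolding n by (simp add: cosh_field_def field_simps)
  qed
  show ?thesis
    unfolding e by simp
qed

text \<open>The constant q^(-1/8) is the exp(\<alpha>^2/4) of the Gaussian integral.\<close>

lemma h_integral_0:
  assumes "0 < \<alpha>" "q = exp (- 2 * \<alpha> ^ 2)"
  shows "h_integral \<alpha> q 0 0 0 0 = of_real (sqrt pi * q powr (- 1 / 8))"
proof -
  have "q powr (- 1 / 8) = exp (\<alpha> ^ 2 / 4)"
    by (simp add: assms(2) powr_def)
  moreover have "h_prod z q 0 = 1" for z
    by (simp add: h_prod_def)
  then have "h_weight \<alpha> q [0, 0, 0, 0] = (\<lambda>t. of_real (exp (- (t ^ 2)) * cosh (\<alpha> * t)))"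
    by (simp add: fun_eq_iff h_weight_def h_prods_4)
  then have "h_integral \<alpha> q 0 0 0 0 = of_real (LBINT t. exp (- (t ^ 2)) * cosh (\<alpha> * t))"
    unfolding h_integral_def by (simp only: integral_complex_of_real)
  ultimately show ?thesis
    by (simp only: gaussian_cosh_integral)
qed

text \<open>The parameters go to 0 one by one: removing \<open>a\<close> yields the factors with ab,
  ac, ad, removing \<open>b\<close> those with bc, bd, removing \<open>c\<close> the one with cd,
  and removing \<open>d\<close> none. After the first removal the product of the parameters is 0, so
  the factor on the left is 1.\<close>

lemma h_integral_eq:
  assumes "0 < \<alpha>" "q = exp (- 2 * \<alpha> ^ 2)" "norm (a * b * c * d) < q ^ 3"
  shows "qpoch_inf (a * b * c * d / of_real (q ^ 3)) q * h_integral \<alpha> q a b c d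
       = of_real (sqrt pi * q powr (- 1 / 8))
         * qpochs_inf [a * b / of_real q, a * c / of_real q, a * d / of_real q,
                       b * c / of_real q, b * d / of_real q, c * d / of_real q] q"
proof -
  have q: "0 < q" using assms by simp
  have 1: "h_integral \<alpha> q 0 b c d = qpoch_inf (b * c / of_real q) q * qpoch_inf (b * d / of_real q) q
      * h_integral \<alpha> q 0 0 c d"
    using h_integral_remove[OF assms(1,2), of b 0 c d] q
    unfolding h_integral_def h_weight_permute(1)[of \<alpha> q b] by simp
  have 2: "h_integral \<alpha> q 0 0 c d = qpoch_inf (c * d / of_real q) q * h_integral \<alpha> q 0 0 0 d"
    using h_integral_remove[OF assms(1,2), of c 0 0 d] q
    unfolding h_integral_def h_weight_permute(2)[of \<alpha> q c] by simp
  have 3: "h_integral \<alpha> q 0 0 0 d = h_integral \<alpha> q 0 0 0 0"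
    using h_integral_remove[OF assms(1,2), of d 0 0 0] q
    unfolding h_integral_def h_weight_permute(3)[of \<alpha> q d] by simp
  show ?thesis
    unfolding h_integral_remove[OF assms] 1 2 3 h_integral_0[OF assms(1,2)]
    by (simp add: qpochs_inf_def mult_ac)
qed

section \<open>The terminating series\<close>

text \<open>All factors have real part 1. The first two lower parameters of the series are purely
  imaginary, so their shifted factorials may be divided by.\<close>

lemma qpoch_imaginary_nonzero: "qpoch (\<i> * of_real r) q n \<noteq> 0"
proof -
  have "Re (1 - \<i> * of_real r * of_real (q ^ k)) = 1" for k
    by (simp del: of_real_power)
  then have "1 - \<i> * of_real r * of_real (q ^ k) \<noteq> 0" for k
    by (metis zero_complex.simps(1) zero_neq_one)
  then show ?thesis by (simp add: qpoch_def)
qed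

lemma qpoch_power_int_eq_0:
  assumes "0 < q" "k < n"
  shows "qpoch (of_real (q powi - int k)) q n = 0"
proof -
  have "1 - complex_of_real (q powi - int k) * of_real (q ^ k) = 0"
    using assms(1) by (simp add: power_int_minus flip: of_real_mult)
  then show ?thesis
    unfolding qpoch_def using assms(2) by (intro prod_zero) auto
qed

text \<open>With four upper and three lower parameters the exponent 1 + s - r is 0, so the sign and
  the power of q disappear; the first upper parameter kills all terms beyond
  \<open>k\<close>.\<close>

lemma qhyp_terminating:
  assumes "0 < q"
  shows "qhyp [of_real (q powi - int k), B, C, D] [u, v, e] q w
       = (\<Sum>n\<le>k. qpoch (of_real (q powi - int k)) q n * qpoch B q n * qpoch C q n * qpoch D q n
           / (qpoch (of_real q) q n * qpoch u q n * qpoch v q n * qpoch e q n) * w ^ n)"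
  unfolding qhyp_def
  by (subst suminf_finite[of "{..k}"])
    (auto simp: qpochs_def qpoch_power_int_eq_0[OF assms] mult.assoc
      simp del: of_real_power_int)

lemma h_prod_split:
  assumes "0 < q" "q < 1"
  shows "h_prod (\<i> * of_real (sinh s)) q p = qpoch (\<i> * p * of_real (exp s)) q n
      * qpoch (- \<i> * p * of_real (exp (- s))) q n * h_prod (\<i> * of_real (sinh s)) q (p * of_real (q ^ n))"
  unfolding h_prod_eq_qpoch_inf[OF assms]
  using qpoch_inf_split[OF assms, of "\<i> * p * of_real (exp s)" n]
    qpoch_inf_split[OF assms, of "- \<i> * p * of_real (exp (- s))" n]
  by (simp add: mult_ac)

text \<open>The t-dependent denominators of the n-th term are exactly the first n factors of each of
  the two products forming h(i sinh \<alpha> t; a). Cancelling them replaces \<open>a\<close> by a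
  q^n, so every term depends on \<open>t\<close> only through a weight again.\<close>

lemma h_weight_qhyp:
  assumes "0 < q" "q < 1"
  shows "h_weight \<alpha> q [of_real a, b, c, d] t
     * qhyp [of_real (q powi - int k), B, C, D]
         [\<i> * of_real (a * exp (\<alpha> * t)), - \<i> * of_real (a * exp (- \<alpha> * t)), e] q w
     = (\<Sum>n\<le>k. qpoch (of_real (q powi - int k)) q n * qpoch B q n * qpoch C q n * qpoch D q n
           / (qpoch (of_real q) q n * qpoch e q n) * w ^ n
           * h_weight \<alpha> q [of_real a * of_real (q ^ n), b, c, d] t)"
proof -
  let ?u = "\<i> * of_real (a * exp (\<alpha> * t))" and ?v = "- \<i> * of_real (a * exp (- \<alpha> * t))"
  have nz: "qpoch ?u q n \<noteq> 0" "qpoch ?v q n \<noteq> 0" for n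
    using qpoch_imaginary_nonzero[of "a * exp (\<alpha> * t)" q n]
      qpoch_imaginary_nonzero[of "- (a * exp (- \<alpha> * t))" q n] by simp_all
  have weight: "h_weight \<alpha> q [of_real a, b, c, d] t
     = qpoch ?u q n * qpoch ?v q n * h_weight \<alpha> q [of_real a * of_real (q ^ n), b, c, d] t" for n
    unfolding h_weight_def h_prods_4
    by (subst h_prod_split[OF assms, of "\<alpha> * t" "of_real a" n]) (simp add: mult_ac)
  have "h_weight \<alpha> q [of_real a, b, c, d] t
      * (X / (Y * qpoch ?u q n * qpoch ?v q n * Z) * W)
     = X / (Y * Z) * W * h_weight \<alpha> q [of_real a * of_real (q ^ n), b, c, d] t" for n X Y Z W
  proof -
    have "U * V * H * (X / (Y * U * V * Z) * W) = X / (Y * Z) * W * H" if "U \<noteq> 0" "V \<noteq> 0" for U V H :: complex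
      using that by simp
    from this[OF nz] show ?thesis by (subst weight)
  qed
  then show ?thesis
    unfolding qhyp_terminating[OF assms(1)] sum_distrib_left by simp
qed

section \<open>A summable q-series\<close>

lemma sum_qpoch_quotient:
  assumes "0 < q" "q < 1"
  shows "(\<Sum>n\<le>m. qpoch c q n / qpoch (of_real q) q n * of_real q ^ n)
       = qpoch (c * of_real q) q m / qpoch (of_real q) q m"
proof (induction m)
  case (Suc m)
  have nz: "qpoch (of_real q) q n \<noteq> 0" for n
    using assms by (intro qpoch_nonzero) auto
  define Q where "Q = complex_of_real q ^ Suc m"
  have q_Suc: "qpoch (of_real q) q (Suc m) = qpoch (of_real q) q m * (1 - Q)"
    by (simp add: qpoch_Suc Q_def)
  have Q: "1 - Q \<noteq> 0"
    using nz[of "Suc m"] unfolding q_Suc by simp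
  have "(\<Sum>n\<le>Suc m. qpoch c q n / qpoch (of_real q) q n * of_real q ^ n)
      = qpoch (c * of_real q) q m / qpoch (of_real q) q m
        + (1 - c) * qpoch (c * of_real q) q m / (qpoch (of_real q) q m * (1 - Q)) * Q"
    unfolding sum.atMost_Suc Suc.IH q_Suc qpoch_Suc_shift[of c] Q_def ..
  \<comment> \<open>Over the common denominator the numerators combine as (1 - Q) + (1 - c) Q = 1 -
    cQ.\<close>
  also have "\<dots> = qpoch (c * of_real q) q m * (1 - c * Q) / (qpoch (of_real q) q m * (1 - Q))"
    using nz[of m] Q by (simp add: field_simps)
  also have "\<dots> = qpoch (c * of_real q) q (Suc m) / qpoch (of_real q) q (Suc m)"
    unfolding q_Suc by (simp add: qpoch_Suc Q_def mult_ac)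
  finally show ?case .
qed simp

text \<open>At c = q^(-k) and m = k the closed form has the numerator (q^(1-k); q)_k, whose last
  factor, of index k - 1, is 0. For k = 0 that product is empty, hence the condition on
  \<open>k\<close>.\<close>

lemma sum_qpoch_power_int:
  assumes "0 < q" "q < 1" "0 < k"
  shows "(\<Sum>n\<le>k. qpoch (of_real (q powi - int k)) q n / qpoch (of_real q) q n * of_real q ^ n) = 0"
proof -
  obtain j where k: "k = Suc j" using assms(3) gr0_implies_Suc by blast
  have "complex_of_real (q powi - int k) * of_real q = of_real (q powi - int j)"
    unfolding k power_int_minus power_int_of_nat using assms(1) by (simp add: field_simps)
  then have "qpoch (complex_of_real (q powi - int k) * of_real q) q k = 0"
    using qpoch_power_int_eq_0[OF assms(1), of j k] by (simp only: k lessI)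
  then show ?thesis
    unfolding sum_qpoch_quotient[OF assms(1,2)] by simp
qed

text \<open>By the q-difference equation the integral at \<open>a q ^ n\<close> cancels the shifted factorials of the
  series, leaving the sum of \<open>(q ^ (- k); q)\<^sub>n / (q; q)\<^sub>n q ^ n\<close>, which vanishes unless \<open>k = 0\<close>.\<close>

lemma
  fixes a :: real and b c d :: complex and \<alpha> q :: real and k :: nat
  assumes "0 < \<alpha>" "q = exp (- 2 * \<alpha> ^ 2)" "norm (of_real a * b * c * d) < q ^ 3"
  defines "F \<equiv> \<lambda>t. h_weight \<alpha> q [of_real a, b, c, d] t
     * qhyp [of_real (q powi - int k), of_real a * b / of_real q, of_real a * c / of_real q, of_real a * d / of_real q]
         [\<i> * of_real (a * exp (\<alpha> * t)), - \<i> * of_real (a * exp (- \<alpha> * t)),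
          of_real a * b * c * d / of_real (q ^ 3)] q (of_real q)"
  shows integrable_h_weight_qhyp: "integrable lborel F"
    and integral_h_weight_qhyp: "(LBINT t. F t) = (if k = 0 then h_integral \<alpha> q (of_real a) b c d else 0)"
proof -
  have q: "0 < q" "q < 1" using assms by auto
  define e where "e = of_real a * b * c * d / of_real (q ^ 3)"
  define B where "B y n = qpoch (of_real a * y / of_real q) q n" for y n
  define g where "g n = qpoch (of_real (q powi - int k)) q n * B b n * B c n * B d n
     / (qpoch (of_real q) q n * qpoch e q n) * of_real q ^ n" for n
  have F: "F t = (\<Sum>n\<le>k. g n * h_weight \<alpha> q [of_real a * of_real (q ^ n), b, c, d] t)" for t
    unfolding F_def h_weight_qhyp[OF q] g_def B_def e_def ..
  have "norm (of_real a * of_real (q ^ n) * b * c * d) < q ^ 3" for n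
  proof -
    have "norm (of_real a * of_real (q ^ n) * b * c * d) = norm (of_real a * b * c * d) * q ^ n"
      using q by (simp add: norm_mult norm_power mult_ac)
    also have "\<dots> \<le> norm (of_real a * b * c * d) * 1"
      using q by (intro mult_left_mono power_le_one) auto
    finally show ?thesis using assms(3) by simp
  qed
  then have int: "integrable lborel (h_weight \<alpha> q [of_real a * of_real (q ^ n), b, c, d])" for n
    by (intro integrable_h_weight assms)
  show "integrable lborel F"
    unfolding F[abs_def] by (intro Bochner_Integration.integrable_sum integrable_mult_right int)
  \<comment> \<open>This keeps the shifted factorials of the third lower parameter nonzero, so that
    they cancel against those that \<open>h_integral_qpoch\<close> produces.\<close>
  have "norm e < 1"
    using assms(3) q by (simp add: e_def norm_divide norm_power)
  then have nz: "qpoch e q n \<noteq> 0" for n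
    using q by (intro qpoch_nonzero)
  have "(LBINT t. F t) = (\<Sum>n\<le>k. g n * h_integral \<alpha> q (of_real a * of_real (q ^ n)) b c d)"
    unfolding F h_integral_def
    by (subst Bochner_Integration.integral_sum[OF integrable_mult_right[OF int]])
      (simp only: integral_mult_right_zero)
  also have "\<dots> = (\<Sum>n\<le>k. qpoch (of_real (q powi - int k)) q n / qpoch (of_real q) q n * of_real q ^ n
      * h_integral \<alpha> q (of_real a) b c d)"
  proof (rule sum.cong)
    fix n
    have "B b n * B c n * B d n * h_integral \<alpha> q (of_real a * of_real (q ^ n)) b c d
        = qpoch e q n * h_integral \<alpha> q (of_real a) b c d"
      unfolding B_def e_def using h_integral_qpoch[OF assms(1-3), of n] by simp
    then have cancel: "X / (Y * qpoch e q n) * Z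
        * (B b n * B c n * B d n * h_integral \<alpha> q (of_real a * of_real (q ^ n)) b c d)
        = X / Y * Z * h_integral \<alpha> q (of_real a) b c d" for X Y Z
      using nz[of n] by simp
    have "g n * h_integral \<alpha> q (of_real a * of_real (q ^ n)) b c d
      = qpoch (of_real (q powi - int k)) q n / (qpoch (of_real q) q n * qpoch e q n) * of_real q ^ n
        * (B b n * B c n * B d n * h_integral \<alpha> q (of_real a * of_real (q ^ n)) b c d)"
      unfolding g_def by simp
    then show "g n * h_integral \<alpha> q (of_real a * of_real (q ^ n)) b c d
      = qpoch (of_real (q powi - int k)) q n / qpoch (of_real q) q n * of_real q ^ n
        * h_integral \<alpha> q (of_real a) b c d"
      unfolding cancel .
  qed simp
  also have "\<dots> = (if k = 0 then h_integral \<alpha> q (of_real a) b c d else 0)"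
    unfolding sum_distrib_right[symmetric] using sum_qpoch_power_int[OF q, of k] by simp
  finally show "(LBINT t. F t) = \<dots>" .
qed

section \<open>Termwise integration\<close>

theorem theorem16:
  fixes \<alpha> q a x :: real and b c d :: complex
  assumes "\<alpha> > 0" and "q = exp (- 2 * \<alpha> ^ 2)"
    and "0 < a" and "a < x" and "x < 1"
    and "norm (of_real a * b * c * d / of_real (q ^ 3)) < 1"
    \<comment> \<open>the left-hand side (integral of a series) converges absolutely\<close>
    and "\<And>t. summable (\<lambda>k. norm (series_term \<alpha> q a b c d x t k))"
    and "integrable lborel
           (\<lambda>t. norm (h_weight \<alpha> q [of_real a, b, c, d] t)
                * (\<Sum>k. norm (series_term \<alpha> q a b c d x t k)))"
  shows "(LBINT t. h_weight \<alpha> q [of_real a, b, c, d] t * (\<Sum>k. series_term \<alpha> q a b c d x t k))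
       = of_real (sqrt pi * q powr (- 1 / 8))
         * (qpochs_inf
              [of_real a * b / of_real q, of_real a * c / of_real q, of_real a * d / of_real q,
               b * c / of_real q, b * d / of_real q, c * d / of_real q] q
            / qpoch_inf (of_real a * b * c * d / of_real (q ^ 3)) q)
         * (of_real (x powr \<alpha>) * qpoch_real (of_real (a / x)) q \<alpha>
            / qpoch_real (of_real q) q \<alpha>)"
proof -
  have q: "0 < q" "q < 1" using assms(1,2) by auto
  let ?e = "of_real a * b * c * d / of_real (q ^ 3)"
  let ?h = "h_weight \<alpha> q [of_real a, b, c, d]"
  let ?s = "series_term \<alpha> q a b c d x"
  let ?J = "h_integral \<alpha> q (of_real a) b c d"
  have small: "norm (of_real a * b * c * d) < q ^ 3"
    using assms(6) q by (simp add: norm_divide norm_power)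
  \<comment> \<open>The part of the k-th term that is free of \<open>t\<close>; it can be taken out
    of the integral.\<close>
  define K where "K k = of_real (x powr (\<alpha> + real k)) * qpoch_real (of_real (a / x)) q (\<alpha> + real k)
       / (of_real (a ^ k) * qpoch_real (of_real q) q (\<alpha> + real k))" for k
  define F where "F k t = ?h t
     * qhyp [of_real (q powi - int k), of_real a * b / of_real q, of_real a * c / of_real q, of_real a * d / of_real q]
         [\<i> * of_real (a * exp (\<alpha> * t)), - \<i> * of_real (a * exp (- \<alpha> * t)), ?e] q (of_real q)" for k t
  have hs: "?h t * ?s t k = K k * F k t" for t k
    unfolding series_term_def K_def F_def by (simp only: mult_ac)
  have int: "integrable lborel (\<lambda>t. ?h t * ?s t k)" for k
    unfolding hs F_def by (intro integrable_mult_right integrable_h_weight_qhyp assms small)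
  have int': "integrable lborel (\<lambda>t. K k * F k t)" for k
    using int[of k] unfolding hs .
  have int_F: "(LBINT t. F k t) = (if k = 0 then ?J else 0)" for k
    unfolding F_def by (rule integral_h_weight_qhyp[OF assms(1,2) small])
  \<comment> \<open>Only k = 0 contributes, so all nonempty partial sums have the same integral,
    which is then the limit as well.\<close>
  have partial: "(LBINT t. \<Sum>k<m. ?h t * ?s t k) = K 0 * ?J" if "0 < m" for m
  proof -
    have "(LBINT t. \<Sum>k<m. ?h t * ?s t k) = (\<Sum>k<m. K k * (if k = 0 then ?J else 0))"
      unfolding hs Bochner_Integration.integral_sum[OF int'] integral_mult_right_zero int_F ..
    also have "\<dots> = (\<Sum>k<m. if k = 0 then K 0 * ?J else 0)"
      by (rule sum.cong) auto
    also have "\<dots> = K 0 * ?J"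
      using that by simp
    finally show ?thesis .
  qed
  have lim: "(\<lambda>m. \<Sum>k<m. ?h t * ?s t k) \<longlonglongrightarrow> ?h t * (\<Sum>k. ?s t k)" for t
  proof -
    have "(\<lambda>m. \<Sum>k<m. ?s t k) \<longlonglongrightarrow> (\<Sum>k. ?s t k)"
      by (rule summable_LIMSEQ[OF summable_norm_cancel[OF assms(7)]])
    then show ?thesis
      unfolding sum_distrib_left[symmetric] by (rule tendsto_mult_left)
  qed
  have meas: "(\<lambda>t. \<Sum>k<m. ?h t * ?s t k) \<in> borel_measurable lborel" for m
    by (intro borel_measurable_sum borel_measurable_integrable int)
  \<comment> \<open>The sum of the absolute values, integrable against the weight by assumption,
    dominates all partial sums.\<close>
  have "(\<lambda>m. LBINT t. \<Sum>k<m. ?h t * ?s t k) \<longlonglongrightarrow> (LBINT t. ?h t * (\<Sum>k. ?s t k))"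
  proof (rule integral_dominated_convergence[OF _ meas assms(8)])
    show "(\<lambda>t. ?h t * (\<Sum>k. ?s t k)) \<in> borel_measurable lborel"
      by (rule borel_measurable_LIMSEQ_metric[OF meas lim])
    show "AE t in lborel. (\<lambda>m. \<Sum>k<m. ?h t * ?s t k) \<longlonglongrightarrow> ?h t * (\<Sum>k. ?s t k)"
      using lim by simp
    have "norm (\<Sum>k<m. ?h t * ?s t k) \<le> norm (?h t) * (\<Sum>k. norm (?s t k))" for m t
    proof -
      have "norm (\<Sum>k<m. ?s t k) \<le> (\<Sum>k<m. norm (?s t k))"
        by (rule norm_sum)
      also have "\<dots> \<le> (\<Sum>k. norm (?s t k))"
        by (intro sum_le_suminf assms(7)) auto
      finally show ?thesis
        unfolding sum_distrib_left[symmetric] norm_mult by (intro mult_left_mono) auto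
    qed
    then show "AE t in lborel. norm (\<Sum>k<m. ?h t * ?s t k) \<le> norm (?h t) * (\<Sum>k. norm (?s t k))" for m
      by simp
  qed
  moreover have "(\<lambda>m. LBINT t. \<Sum>k<m. ?h t * ?s t k) \<longlonglongrightarrow> K 0 * ?J"
    by (rule tendsto_eventually) (use partial in \<open>auto simp: eventually_sequentially intro!: exI[of _ 1]\<close>)
  ultimately have "(LBINT t. ?h t * (\<Sum>k. ?s t k)) = K 0 * ?J"
    by (rule LIMSEQ_unique)
  moreover have "qpoch_inf ?e q \<noteq> 0"
    by (rule qpoch_inf_nonzero[OF q assms(6)])
  then have "?J = of_real (sqrt pi * q powr (- 1 / 8))
         * (qpochs_inf
              [of_real a * b / of_real q, of_real a * c / of_real q, of_real a * d / of_real q,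
               b * c / of_real q, b * d / of_real q, c * d / of_real q] q
            / qpoch_inf ?e q)"
    using h_integral_eq[OF assms(1,2) small] by (simp add: eq_divide_eq mult.commute)
  moreover have "K 0 = of_real (x powr \<alpha>) * qpoch_real (of_real (a / x)) q \<alpha> / qpoch_real (of_real q) q \<alpha>"
    by (simp add: K_def)
  ultimately show ?thesis
    by (simp only: mult.commute)
qed

end
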